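(* Let $G_n$ ($n\ge1$) be the linear crossed polyomino chain with $n$ four-order complete graphs. Then its multiplicative degree-Kirchhoff index is $$K\!f^{*}(G_n)=\frac{25n^3+65n^2+64n+8}{6}.$$
   Context: For $n\geq1$, $G_n$ is the simple graph with vertex set $\{1,\ldots,n+1\}\cup\{1',\ldots,(n+1)'\}$ and edge set consisting of the vertical edges $ii'$ for $1\le i\le n+1$ together with, for each $1\le i\le n$, the edges $i(i+1)$, $i'(i+1)'$, $i(i+1)'$, $i'(i+1)$. The multiplicative degree-Kirchhoff index is $K\!f^*(G)=\sum_{\{u,v\}}d_ud_v r_{uv}$, summed over unordered pairs of distinct vertices, where $d_u$ is the degree of $u$ and $r_{uv}$ is the effective resistance between $u$ and $v$ when every edge is a unit resistor. *)

theory Defs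
  imports Complex_Main
begin

text \<open>A simple graph is given by its vertex set \<open>V\<close> and an edge set \<open>E\<close> whose members are
  two-element subsets of \<open>V\<close>.\<close>

definition neighbours :: "'a set \<Rightarrow> 'a set set \<Rightarrow> 'a \<Rightarrow> 'a set" where
  "neighbours V E x = {y \<in> V. {x, y} \<in> E}"

definition degree :: "'a set \<Rightarrow> 'a set set \<Rightarrow> 'a \<Rightarrow> nat" where
  "degree V E x = card (neighbours V E x)"

text \<open>With unit resistors, Ohm's law makes the current along an edge from \<open>x\<close> to \<open>y\<close> equal to
  \<open>\<phi> x - \<phi> y\<close>. The condition below is Kirchhoff's current law for a unit current entering the
  network at \<open>u\<close> and leaving it at \<open>v\<close>; the effective resistance is the resulting
  potential difference.\<close>

definition unit_current_potential ::
  "'a set \<Rightarrow> 'a set set \<Rightarrow> 'a \<Rightarrow> 'a \<Rightarrow> ('a \<Rightarrow> real) \<Rightarrow> bool" where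
  "unit_current_potential V E u v \<phi> \<longleftrightarrow>
     (\<forall>x\<in>V. (\<Sum>y\<in>neighbours V E x. \<phi> x - \<phi> y) = of_bool (x = u) - of_bool (x = v))"

definition effective_resistance :: "'a set \<Rightarrow> 'a set set \<Rightarrow> 'a \<Rightarrow> 'a \<Rightarrow> real" where
  "effective_resistance V E u v =
     (THE R. \<exists>\<phi>. unit_current_potential V E u v \<phi> \<and> R = \<phi> u - \<phi> v)"

text \<open>The sum ranges over unordered pairs. The summand is independent of the order in which a
  pair is enumerated because the effective resistance is symmetric, see
  \<open>effective_resistance_commute\<close> and \<open>pair_term_eq\<close> below.\<close>

definition mult_degree_kirchhoff :: "'a set \<Rightarrow> 'a set set \<Rightarrow> real" where
  "mult_degree_kirchhoff V E =
     (\<Sum>e | e \<subseteq> V \<and> card e = 2.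
        (THE c. \<exists>u v. e = {u, v} \<and>
           c = real (degree V E u) * real (degree V E v) * effective_resistance V E u v))"

lemma effective_resistance_eqI:
  fixes V :: "'a set" and E :: "'a set set" and \<phi> :: "'a \<Rightarrow> real"
  assumes fin: "finite V" and uv: "u \<in> V" "v \<in> V"
    and phi: "unit_current_potential V E u v \<phi>"
  shows "effective_resistance V E u v = \<phi> u - \<phi> v"
proof -
  have green: "f u - f v = (\<Sum>x\<in>V. \<Sum>y\<in>V. of_bool ({x, y} \<in> E) * (f x * (g x - g y)))"
    if "unit_current_potential V E u v g" for f g :: "'a \<Rightarrow> real"
  proof -
    have "(\<Sum>y\<in>V. of_bool ({x, y} \<in> E) * (f x * (g x - g y)))
        = f x * of_bool (x = u) - f x * of_bool (x = v)" if x: "x \<in> V" for x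
    proof -
      have "(\<Sum>y\<in>V. of_bool ({x, y} \<in> E) * (f x * (g x - g y)))
          = (\<Sum>y\<in>V. if {x, y} \<in> E then f x * (g x - g y) else 0)"
        by (intro sum.cong) auto
      also have "\<dots> = (\<Sum>y\<in>neighbours V E x. f x * (g x - g y))"
        unfolding neighbours_def by (rule sum.inter_filter[OF fin, symmetric])
      also have "\<dots> = f x * (\<Sum>y\<in>neighbours V E x. g x - g y)"
        by (simp add: sum_distrib_left)
      also have "\<dots> = f x * of_bool (x = u) - f x * of_bool (x = v)"
        using that \<open>unit_current_potential V E u v g\<close> x
        by (simp only: unit_current_potential_def right_diff_distrib)
      finally show ?thesis .
    qed
    then have "(\<Sum>x\<in>V. \<Sum>y\<in>V. of_bool ({x, y} \<in> E) * (f x * (g x - g y)))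
        = (\<Sum>x\<in>V. f x * of_bool (x = u)) - (\<Sum>x\<in>V. f x * of_bool (x = v))"
      by (simp only: sum_subtractf cong: sum.cong)
    moreover have "(\<Sum>x\<in>V. f x * of_bool (x = w)) = f w" if "w \<in> V" for w
    proof -
      have "(\<Sum>x\<in>V. f x * of_bool (x = w)) = (\<Sum>x\<in>V. if x = w then f x else 0)"
        by (intro sum.cong) auto
      then show ?thesis using fin \<open>w \<in> V\<close> by (simp add: sum.delta)
    qed
    ultimately show ?thesis using uv by simp
  qed
  have uniq: "\<psi> u - \<psi> v = \<phi> u - \<phi> v" if psi: "unit_current_potential V E u v \<psi>" for \<psi> :: "'a \<Rightarrow> real"
  proof -
    let ?S = "\<lambda>f g :: 'a \<Rightarrow> real. \<Sum>x\<in>V. \<Sum>y\<in>V. of_bool ({x, y} \<in> E) * (f x * (g x - g y))"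
    let ?D = "\<lambda>x y. of_bool ({x, y} \<in> E) * (\<phi> x * \<psi> y)"
    have "?S \<psi> \<phi> - ?S \<phi> \<psi> = (\<Sum>x\<in>V. \<Sum>y\<in>V. ?D x y) - (\<Sum>x\<in>V. \<Sum>y\<in>V. ?D y x)"
      unfolding sum_subtractf[symmetric]
    proof (intro sum.cong refl)
      fix x y :: 'a
      have sym: "{y, x} \<in> E \<longleftrightarrow> {x, y} \<in> E" by (simp only: insert_commute)
      show "of_bool ({x, y} \<in> E) * (\<psi> x * (\<phi> x - \<phi> y))
          - of_bool ({x, y} \<in> E) * (\<phi> x * (\<psi> x - \<psi> y)) = ?D x y - ?D y x"
        unfolding sym by (cases "{x, y} \<in> E") (simp_all add: algebra_simps)
    qed
    also have "\<dots> = 0" by (simp only: sum.swap[of ?D V V] diff_self)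
    finally show ?thesis
      using green[OF phi, of \<psi>] green[OF psi, of \<phi>] by linarith
  qed
  show ?thesis
    unfolding effective_resistance_def
    by (rule the_equality) (use phi uniq in blast)+
qed

lemma effective_resistance_commute:
  fixes V :: "'a set"
  shows "effective_resistance V E u v = effective_resistance V E v u"
proof -
  have neg: "unit_current_potential V E b a (\<lambda>x. - f x)"
    if f: "unit_current_potential V E a b f" for a b and f :: "'a \<Rightarrow> real"
    unfolding unit_current_potential_def
  proof
    fix x assume "x \<in> V"
    have "(\<Sum>y\<in>neighbours V E x. - f x - - f y) = (\<Sum>y\<in>neighbours V E x. - (f x - f y))"
      by (rule sum.cong) simp_all
    also have "\<dots> = - (\<Sum>y\<in>neighbours V E x. f x - f y)"
      by (rule sum_negf)
    also have "\<dots> = - (of_bool (x = a) - of_bool (x = b))"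
      using f \<open>x \<in> V\<close> unfolding unit_current_potential_def by metis
    finally show "(\<Sum>y\<in>neighbours V E x. - f x - - f y) = of_bool (x = b) - of_bool (x = a)"
      by linarith
  qed
  have *: "\<exists>\<phi>. unit_current_potential V E b a \<phi> \<and> R = \<phi> b - \<phi> a"
    if ex: "\<exists>\<phi>. unit_current_potential V E a b \<phi> \<and> R = \<phi> a - \<phi> b" for a b and R :: real
  proof -
    from ex obtain f where "unit_current_potential V E a b f" "R = f a - f b" by blast
    then have "unit_current_potential V E b a (\<lambda>x. - f x) \<and> R = - f b - - f a"
      by (simp add: neg)
    then show ?thesis by (rule exI[of _ "\<lambda>x. - f x"])
  qed
  show ?thesis
    unfolding effective_resistance_def
    by (rule arg_cong[where f = The], rule ext, rule iffI; erule *)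
qed

lemma pair_term_eq:
  "(THE c. \<exists>a b. {u, v} = {a, b} \<and>
      c = real (degree V E a) * real (degree V E b) * effective_resistance V E a b)
   = real (degree V E u) * real (degree V E v) * effective_resistance V E u v"
proof (rule the_equality)
  let ?t = "\<lambda>a b. real (degree V E a) * real (degree V E b) * effective_resistance V E a b"
  show "\<exists>a b. {u, v} = {a, b} \<and> ?t u v = ?t a b" by blast
  fix c assume "\<exists>a b. {u, v} = {a, b} \<and> c = ?t a b"
  then obtain a b where ab: "{u, v} = {a, b}" and c: "c = ?t a b" by blast
  from ab have "a = u \<and> b = v \<or> a = v \<and> b = u" by (auto simp: doubleton_eq_iff)
  moreover have "?t v u = ?t u v"
    by (simp only: effective_resistance_commute[of V E v u] mult.commute[of "real (degree V E v)"])
  ultimately show "c = ?t u v" using c by (elim disjE conjE) simp_all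
qed

datatype vertex = Unprimed nat | Primed nat

definition crossed_polyomino_verts :: "nat \<Rightarrow> vertex set" where
  "crossed_polyomino_verts n = Unprimed ` {1..n+1} \<union> Primed ` {1..n+1}"

definition crossed_polyomino_edges :: "nat \<Rightarrow> vertex set set" where
  "crossed_polyomino_edges n =
     (\<Union>i\<in>{1..n+1}. {{Unprimed i, Primed i}}) \<union>
     (\<Union>i\<in>{1..n}. {{Unprimed i, Unprimed (i+1)}, {Primed i, Primed (i+1)},
                    {Unprimed i, Primed (i+1)}, {Primed i, Unprimed (i+1)}})"

end

theory Submission imports Defs begin

text \<open>The swap of primed and unprimed vertices splits the Laplacian of the chain. On functions that
  are constant on each column \<open>{i, i'}\<close> it is twice the Laplacian of a path; on
  functions that change sign under the swap the contributions of the neighbouring columns cancel and it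
  is multiplication by \<open>d\<^sub>i + 1\<close>. This gives an explicit Green function, and from it
  \<open>r\<^sub>u\<^sub>v = \<bar>i - j\<bar>/4 + 1/(2(d\<^sub>i + 1)) + 1/(2(d\<^sub>j + 1))\<close> for \<open>u\<close>, \<open>v\<close> in distinct columns \<open>i\<close>, \<open>j\<close>
  and \<open>r\<^sub>u\<^sub>v = 2/(d\<^sub>i + 1)\<close> for the two vertices of column \<open>i\<close>. The four ordered pairs from columns
  \<open>i\<close>, \<open>j\<close> thus contribute \<open>d\<^sub>i d\<^sub>j (\<bar>i - j\<bar> + 2/(d\<^sub>i + 1) + 2/(d\<^sub>j + 1))\<close>
  in total, also when \<open>i = j\<close>, and it remains to sum this over \<open>i\<close> and \<open>j\<close>.\<close>

section \<open>Sums over unordered pairs\<close>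

lemma sum_two_subsets:
  fixes g :: "'a \<Rightarrow> 'a \<Rightarrow> real"
  assumes fin: "finite V" and sym: "\<And>u v. g u v = g v u" and diag: "\<And>u. g u u = 0"
    and F: "\<And>u v. u \<in> V \<Longrightarrow> v \<in> V \<Longrightarrow> u \<noteq> v \<Longrightarrow> F {u, v} = g u v"
  shows "(\<Sum>e | e \<subseteq> V \<and> card e = 2. F e) = (\<Sum>u\<in>V. \<Sum>v\<in>V. g u v) / 2"
proof -
  let ?S = "{p \<in> V \<times> V. fst p \<noteq> snd p}" and ?T = "{e. e \<subseteq> V \<and> card e = 2}"
  let ?h = "\<lambda>p :: 'a \<times> 'a. {fst p, snd p}" and ?g = "\<lambda>p. g (fst p) (snd p)"
  have finT: "finite ?T" using fin by (simp add: finite_subset[of _ "Pow V"] subset_eq)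
  \<comment> \<open>Over each two-element set lie exactly two ordered pairs, with equal values by
    \<open>sym\<close>; hence the factor 2.\<close>
  have fibre: "(\<Sum>p | p \<in> ?S \<and> ?h p = e. ?g p) = 2 * F e" if "e \<in> ?T" for e
  proof -
    from that obtain a b where e: "e = {a, b}" "a \<noteq> b" "a \<in> V" "b \<in> V"
      by (auto simp: card_2_iff)
    then have "{p. p \<in> ?S \<and> ?h p = e} = {(a, b), (b, a)}"
      by (auto simp: doubleton_eq_iff)
    then show ?thesis using e F[of a b] sym[of b a] by simp
  qed
  have "(\<Sum>u\<in>V. \<Sum>v\<in>V. g u v) = (\<Sum>p\<in>V \<times> V. ?g p)"
    by (simp add: sum.cartesian_product case_prod_unfold)
  also have "\<dots> = (\<Sum>p\<in>?S. ?g p)"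
    using fin diag by (intro sum.mono_neutral_right) auto
  also have "\<dots> = (\<Sum>e\<in>?T. \<Sum>p | p \<in> ?S \<and> ?h p = e. ?g p)"
    using fin finT by (intro sum.group[symmetric]) (auto simp: card_insert_if)
  also have "\<dots> = 2 * (\<Sum>e\<in>?T. F e)"
    by (simp only: sum_distrib_left fibre cong: sum.cong)
  finally show ?thesis by simp
qed

section \<open>Columns, neighbourhoods and degrees\<close>

fun column :: "vertex \<Rightarrow> nat" where
  "column (Unprimed i) = i"
| "column (Primed i) = i"

fun mate :: "vertex \<Rightarrow> vertex" where
  "mate (Unprimed i) = Primed i"
| "mate (Primed i) = Unprimed i"

definition column_sum :: "(vertex \<Rightarrow> real) \<Rightarrow> nat \<Rightarrow> real" where
  "column_sum f i = f (Unprimed i) + f (Primed i)"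

lemma column_sum_sum:
  "column_sum (\<lambda>u. \<Sum>j\<in>A. h u j) i = (\<Sum>j\<in>A. column_sum (\<lambda>u. h u j) i)"
  by (simp add: column_sum_def sum.distrib)

lemma column_mate [simp]: "column (mate x) = column x"
  by (cases x) auto

lemma mate_neq [simp]: "mate x \<noteq> x" "x \<noteq> mate x"
  by (cases x; simp)+

lemma column_eq_iff: "column x = column y \<longleftrightarrow> x = y \<or> x = mate y"
  by (cases x; cases y) auto

lemma column_sum_column: "column_sum f (column x) = f x + f (mate x)"
  by (cases x) (auto simp: column_sum_def)

lemma mem_crossed_polyomino_verts:
  "x \<in> crossed_polyomino_verts n \<longleftrightarrow> 1 \<le> column x \<and> column x \<le> n + 1"
  by (cases x) (auto simp: crossed_polyomino_verts_def)

lemma finite_crossed_polyomino_verts: "finite (crossed_polyomino_verts n)"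
  by (simp add: crossed_polyomino_verts_def)

lemma sum_crossed_polyomino_verts:
  "(\<Sum>x\<in>crossed_polyomino_verts n. f x) = (\<Sum>i=1..n+1. column_sum f i)"
  unfolding crossed_polyomino_verts_def column_sum_def
  by (subst sum.union_disjoint) (auto simp: sum.reindex inj_on_def sum.distrib)

lemma crossed_polyomino_edge_iff:
  assumes "x \<in> crossed_polyomino_verts n" "y \<in> crossed_polyomino_verts n"
  shows "{x, y} \<in> crossed_polyomino_edges n \<longleftrightarrow>
    y = mate x \<or> column y = column x + 1 \<or> column x = column y + 1"
  using assms unfolding mem_crossed_polyomino_verts crossed_polyomino_edges_def
  by (cases x; cases y) (auto simp: doubleton_eq_iff)

text \<open>A vertex is joined to its mate and to both vertices of each adjacent column, so away
  from the mate only column sums matter. The conditions drop the missing column at either end of the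
  chain.\<close>

lemma sum_neighbours:
  fixes f :: "vertex \<Rightarrow> real"
  assumes x: "x \<in> crossed_polyomino_verts n"
  shows "(\<Sum>y\<in>neighbours (crossed_polyomino_verts n) (crossed_polyomino_edges n) x. f y) =
    f (mate x) + (if 1 < column x then column_sum f (column x - 1) else 0)
      + (if column x \<le> n then column_sum f (column x + 1) else 0)"
proof -
  let ?k = "column x"
  let ?A = "if 1 < ?k then {Unprimed (?k - 1), Primed (?k - 1)} else {}"
  let ?B = "if ?k \<le> n then {Unprimed (?k + 1), Primed (?k + 1)} else {}"
  have "neighbours (crossed_polyomino_verts n) (crossed_polyomino_edges n) x
      = {mate x} \<union> ?A \<union> ?B" (is "?N = ?R")
  proof (rule set_eqI)
    fix y
    have "y \<in> ?N \<longleftrightarrow> 1 \<le> column y \<and> column y \<le> n + 1 \<and>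
        (y = mate x \<or> column y = column x + 1 \<or> column x = column y + 1)"
      using crossed_polyomino_edge_iff[OF x, of y]
      by (auto simp: neighbours_def mem_crossed_polyomino_verts)
    also have "\<dots> \<longleftrightarrow> y \<in> ?R"
      using x unfolding mem_crossed_polyomino_verts by (cases x; cases y) auto
    finally show "y \<in> ?N \<longleftrightarrow> y \<in> ?R" .
  qed
  moreover have "{mate x} \<inter> ?A = {}" "({mate x} \<union> ?A) \<inter> ?B = {}"
    by (cases x; auto)+
  ultimately have "sum f ?N = sum f {mate x} + sum f ?A + sum f ?B"
    by (simp add: sum.union_disjoint)
  moreover have "sum f ?A = (if 1 < ?k then column_sum f (?k - 1) else 0)"
    "sum f ?B = (if ?k \<le> n then column_sum f (?k + 1) else 0)"
    by (auto simp: column_sum_def)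
  ultimately show ?thesis by simp
qed

text \<open>Interior degree 5 with a correction of 2 at each end, so that degree-weighted sums
  become plain sums minus boundary terms.\<close>

definition column_degree :: "nat \<Rightarrow> nat \<Rightarrow> real" where
  "column_degree n i = 5 - 2 * of_bool (i = 1) - 2 * of_bool (i = n + 1)"

lemma degree_crossed_polyomino:
  assumes "n \<ge> 1" "x \<in> crossed_polyomino_verts n"
  shows "real (degree (crossed_polyomino_verts n) (crossed_polyomino_edges n) x)
    = column_degree n (column x)"
proof -
  have "real (degree (crossed_polyomino_verts n) (crossed_polyomino_edges n) x)
      = (\<Sum>y\<in>neighbours (crossed_polyomino_verts n) (crossed_polyomino_edges n) x. 1)"
    by (simp add: degree_def)
  also have "\<dots> = column_degree n (column x)"
    unfolding sum_neighbours[OF assms(2)] using assms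
    by (auto simp: column_sum_def column_degree_def mem_crossed_polyomino_verts)
  finally show ?thesis .
qed

section \<open>Green function and resistances\<close>

definition mate_resistance :: "nat \<Rightarrow> nat \<Rightarrow> real" where
  "mate_resistance n i = 2 / (column_degree n i + 1)"

text \<open>The unit source at \<open>u\<close> is half the symmetric plus half the antisymmetric
  source on its column. The kink of the absolute value has second difference 2, so the factor 1/8
  and the doubled path Laplacian give 1/2; the other part is 1/2 divided by the eigenvalue
  \<open>column_degree n (column u) + 1\<close>.\<close>

definition green :: "nat \<Rightarrow> vertex \<Rightarrow> vertex \<Rightarrow> real" where
  "green n u x = - \<bar>real (column u) - real (column x)\<bar> / 8
     + (of_bool (x = u) - of_bool (x = mate u)) * mate_resistance n (column u) / 4"

lemma column_sum_green:
  "column_sum (\<lambda>y. c - green n u y) i = 2 * c + \<bar>real (column u) - real i\<bar> / 4"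
  by (cases u) (auto simp: column_sum_def green_def)

text \<open>The sink of the Green function is spread over the four end vertices, independently of the
  source \<open>u\<close>, so it cancels in \<open>green n u - green n v\<close>.\<close>

lemma laplacian_green:
  assumes n: "n \<ge> 1" and u: "u \<in> crossed_polyomino_verts n" and x: "x \<in> crossed_polyomino_verts n"
  shows "(\<Sum>y\<in>neighbours (crossed_polyomino_verts n) (crossed_polyomino_edges n) x.
      green n u x - green n u y)
    = of_bool (x = u) - (of_bool (column x = 1) + of_bool (column x = n + 1)) / 4"
proof -
  let ?i = "column u" and ?k = "column x"
  \<comment> \<open>Off the column of \<open>u\<close> the Green function is linear in the column
    number on either side, so only the ends of the chain contribute there.\<close>
  consider "x = u" | "x = mate u" | "?k < ?i" | "?i < ?k"
    using column_eq_iff[of x u] by linarith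
  moreover have "mate (mate u) = u" by (cases u) auto
  moreover have "x \<noteq> u" "x \<noteq> mate u" "mate x \<noteq> u" "mate x \<noteq> mate u" if "?k \<noteq> ?i"
    using that by (metis column_mate)+
  ultimately show ?thesis
    unfolding sum_neighbours[OF x] column_sum_green
    using n u x unfolding mem_crossed_polyomino_verts
    by cases (auto simp: green_def mate_resistance_def column_degree_def of_nat_diff field_simps not_le less_Suc_eq_le)
qed

definition resistance :: "nat \<Rightarrow> vertex \<Rightarrow> vertex \<Rightarrow> real" where
  "resistance n u v = green n u u - green n v u - (green n u v - green n v v)"

lemma effective_resistance_crossed_polyomino:
  assumes "n \<ge> 1" "u \<in> crossed_polyomino_verts n" "v \<in> crossed_polyomino_verts n"
  shows "effective_resistance (crossed_polyomino_verts n) (crossed_polyomino_edges n) u v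
    = resistance n u v"
  unfolding resistance_def
proof (rule effective_resistance_eqI[OF finite_crossed_polyomino_verts assms(2,3)])
  let ?N = "neighbours (crossed_polyomino_verts n) (crossed_polyomino_edges n)"
  show "unit_current_potential (crossed_polyomino_verts n) (crossed_polyomino_edges n) u v
      (\<lambda>x. green n u x - green n v x)"
    unfolding unit_current_potential_def
  proof
    fix x assume x: "x \<in> crossed_polyomino_verts n"
    have "(\<Sum>y\<in>?N x. green n u x - green n v x - (green n u y - green n v y))
        = (\<Sum>y\<in>?N x. green n u x - green n u y) - (\<Sum>y\<in>?N x. green n v x - green n v y)"
      unfolding sum_subtractf[symmetric] by (intro sum.cong) auto
    then show "(\<Sum>y\<in>?N x. green n u x - green n v x - (green n u y - green n v y))
        = of_bool (x = u) - of_bool (x = v)"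
      using assms x by (simp add: laplacian_green)
  qed
qed

text \<open>The antisymmetric parts add up to the \<open>mate_resistance\<close> terms. For
  \<open>i = j\<close> the diagonal vanishes and the two ordered pairs of mates give
  \<open>2 * mate_resistance n i\<close>.\<close>

lemma column_sum_resistance:
  "column_sum (\<lambda>u. column_sum (\<lambda>v. resistance n u v) j) i
    = \<bar>real i - real j\<bar> + mate_resistance n i + mate_resistance n j"
  by (cases "i = j") (auto simp: column_sum_def resistance_def green_def abs_minus_commute)

section \<open>Degree-weighted sums and distance sums on a path\<close>

lemma sum_ends:
  fixes f :: "nat \<Rightarrow> real"
  shows "(\<Sum>i=1..n+1. f i * of_bool (i = 1)) = f 1"
    "(\<Sum>i=1..n+1. f i * of_bool (i = n + 1)) = f (n + 1)"
  by (auto simp: of_bool_def if_distrib sum.delta cong: if_cong)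

lemma sum_column_degree:
  "(\<Sum>i=1..n+1. f i * column_degree n i) = 5 * (\<Sum>i=1..n+1. f i) - 2 * f 1 - 2 * f (n + 1)"
proof -
  have "(\<Sum>i=1..n+1. f i * column_degree n i) = (\<Sum>i=1..n+1. 5 * f i
      - 2 * (f i * of_bool (i = 1)) - 2 * (f i * of_bool (i = n + 1)))"
    by (intro sum.cong) (auto simp: column_degree_def)
  also have "\<dots> = 5 * (\<Sum>i=1..n+1. f i) - 2 * (\<Sum>i=1..n+1. f i * of_bool (i = 1))
      - 2 * (\<Sum>i=1..n+1. f i * of_bool (i = n + 1))"
    by (simp only: sum_subtractf sum_distrib_left)
  finally show ?thesis by (simp only: sum_ends)
qed

text \<open>Two triangular sums, one on each side of \<open>i\<close>. The formula persists for
  \<open>i = m + 1\<close>, one past the range, as the second product is then zero.\<close>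

lemma sum_abs_diff:
  assumes "i \<le> m + 1"
  shows "(\<Sum>j=1..m. \<bar>real i - real j\<bar>)
    = (real i * (real i - 1) + (real m - real i) * (real m + 1 - real i)) / 2"
  using assms
proof (induction m)
  case 0
  then show ?case by (cases i) auto
next
  case (Suc m)
  show ?case
  proof (cases "i \<le> m + 1")
    case True
    then show ?thesis using Suc.IH by (simp add: field_simps)
  next
    case False
    then have i: "i = m + 2" using Suc.prems by simp
    \<comment> \<open>Here \<open>i\<close> lies just past the range, and reversing the order of
      summation leaves a single triangular sum.\<close>
    have "(\<Sum>j=1..Suc m. \<bar>real i - real j\<bar>) = (\<Sum>j=1..Suc m. real (Suc m + 1 - j))"
      unfolding i by (intro sum.cong) auto
    also have "\<dots> = (\<Sum>j=1..Suc m. real j)"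
      by (rule sum.reindex_bij_witness[of _ "\<lambda>j. Suc m + 1 - j" "\<lambda>j. Suc m + 1 - j"]) auto
    also have "\<dots> = real (Suc m) * (real (Suc m) + 1) / 2"
      by (induction m) (auto simp: field_simps)
    finally show ?thesis unfolding i by (simp add: field_simps)
  qed
qed

text \<open>Keeping \<open>c\<close> separate from \<open>m\<close> fixes the summand during the
  induction; both are later \<open>n + 1\<close>.\<close>

lemma sum_path_distances:
  fixes c :: real
  shows "(\<Sum>i=1..m. (real i * (real i - 1) + (c - real i) * (c + 1 - real i)) / 2)
    = real m * ((real m + 1) * (2 * real m + 1) / 3 - (c + 1) * (real m + 1) + c * (c + 1)) / 2"
  by (induction m) (auto simp: field_simps)

lemma sum_mate_resistance:
  assumes "n \<ge> 1"
  shows "(\<Sum>i=1..n+1. mate_resistance n i) = (real n + 2) / 3"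
proof -
  \<comment> \<open>The values are 2/6 inside and 2/4 = 1/3 + 1/6 at the two ends, which are
    distinct since \<open>n \<ge> 1\<close>.\<close>
  have "(\<Sum>i=1..n+1. mate_resistance n i)
      = (\<Sum>i=1..n+1. 1/3 + 1/6 * of_bool (i = 1) + 1/6 * of_bool (i = n + 1))"
    using assms by (intro sum.cong) (auto simp: mate_resistance_def column_degree_def)
  then show ?thesis
    by (simp only: sum.distrib sum_ends[of "\<lambda>_. 1/6"]) simp
qed

theorem theorem3p5:
  fixes n :: nat
  assumes "n \<ge> 1"
  shows "mult_degree_kirchhoff (crossed_polyomino_verts n) (crossed_polyomino_edges n)
       = (25 * real n ^ 3 + 65 * real n ^ 2 + 64 * real n + 8) / 6"
proof -
  let ?V = "crossed_polyomino_verts n" and ?E = "crossed_polyomino_edges n"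
  let ?d = "column_degree n" and ?e = "mate_resistance n"
  let ?g = "\<lambda>u v. ?d (column u) * ?d (column v) * resistance n u v"
  have "mult_degree_kirchhoff ?V ?E = (\<Sum>u\<in>?V. \<Sum>v\<in>?V. ?g u v) / 2"
    unfolding mult_degree_kirchhoff_def
  proof (rule sum_two_subsets[OF finite_crossed_polyomino_verts])
    show "?g u v = ?g v u" for u v
      by (simp add: resistance_def)
    show "?g u u = 0" for u by (simp add: resistance_def)
    show "(THE c. \<exists>a b. {u, v} = {a, b} \<and>
        c = real (degree ?V ?E a) * real (degree ?V ?E b) * effective_resistance ?V ?E a b) = ?g u v"
      if "u \<in> ?V" "v \<in> ?V" for u v
      unfolding pair_term_eq
      using that assms by (simp add: degree_crossed_polyomino effective_resistance_crossed_polyomino)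
  qed
  also have "(\<Sum>u\<in>?V. \<Sum>v\<in>?V. ?g u v)
      = (\<Sum>i=1..n+1. \<Sum>j=1..n+1. column_sum (\<lambda>u. column_sum (\<lambda>v. ?g u v) j) i)"
    unfolding sum_crossed_polyomino_verts by (intro sum.cong refl) (simp only: column_sum_sum)
  also have "\<dots> = (\<Sum>i=1..n+1. \<Sum>j=1..n+1.
      (\<bar>real i - real j\<bar> + ?e i + ?e j) * ?d j * ?d i)"
    unfolding column_sum_resistance[symmetric]
    by (intro sum.cong refl) (simp add: column_sum_def algebra_simps)
  also have "\<dots> = (\<Sum>i=1..n+1. (\<Sum>j=1..n+1.
      (\<bar>real i - real j\<bar> + ?e i + ?e j) * ?d j) * ?d i)"
    by (simp only: sum_distrib_right)
  also have "\<dots> = (25 * real n ^ 3 + 65 * real n ^ 2 + 64 * real n + 8) / 3"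
  proof -
    define A where "A i = (\<Sum>j=1..n+1. \<bar>real i - real j\<bar>)" for i
    have A: "A i = (real i * (real i - 1) + (real (n + 1) - real i) * (real (n + 1) + 1 - real i)) / 2"
      if "i \<in> {1..n+1}" for i
      unfolding A_def using that by (intro sum_abs_diff) simp
    have ends: "?e 1 = 1/2" "?e (n + 1) = 1/2"
      using assms by (auto simp: mate_resistance_def column_degree_def)
    have e: "(\<Sum>i=1..n+1. ?e i) = (real n + 2) / 3"
      by (rule sum_mate_resistance[OF assms])
    \<comment> \<open>The distances from \<open>i\<close> to the two ends add up to
      \<open>n\<close>, so the boundary terms leave no further dependence on \<open>i\<close> beyond
      \<open>A i\<close> and \<open>?e i\<close>.\<close>
    have inner: "(\<Sum>j=1..n+1. (\<bar>real i - real j\<bar> + ?e i + ?e j) * ?d j)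
        = 5 * A i + (5 * real n + 1) * ?e i + (4 - real n) / 3" if i: "i \<in> {1..n+1}" for i
    proof -
      have "(\<Sum>j=1..n+1. (\<bar>real i - real j\<bar> + ?e i + ?e j) * ?d j)
          = 5 * (\<Sum>j=1..n+1. \<bar>real i - real j\<bar> + ?e i + ?e j)
            - 2 * (\<bar>real i - real 1\<bar> + ?e i + ?e 1) - 2 * (\<bar>real i - real (n + 1)\<bar> + ?e i + ?e (n + 1))"
        by (rule sum_column_degree)
      also have "(\<Sum>j=1..n+1. \<bar>real i - real j\<bar> + ?e i + ?e j)
          = A i + (real n + 1) * ?e i + (real n + 2) / 3"
        by (simp only: sum.distrib e A_def) simp
      also have "\<bar>real i - real 1\<bar> = real i - 1" using i by simp
      also have "\<bar>real i - real (n + 1)\<bar> = real n + 1 - real i" using i by simp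
      finally show ?thesis
        unfolding ends by (simp add: field_simps)
    qed
    \<comment> \<open>This is twice the Wiener index of the path on \<open>n + 1\<close>
      vertices.\<close>
    have "(\<Sum>i=1..n+1. A i) = real n * (real n + 1) * (real n + 2) / 3"
    proof -
      have "(\<Sum>i=1..n+1. A i)
          = (\<Sum>i=1..n+1. (real i * (real i - 1) + (real (n + 1) - real i) * (real (n + 1) + 1 - real i)) / 2)"
        using A by (rule sum.cong[OF refl])
      also have "\<dots> = real n * (real n + 1) * (real n + 2) / 3"
        unfolding sum_path_distances by (simp add: field_simps)
      finally show ?thesis .
    qed
    then have outer: "(\<Sum>i=1..n+1. 5 * A i + (5 * real n + 1) * ?e i + (4 - real n) / 3)
        = 5 * (real n * (real n + 1) * (real n + 2) / 3) + (5 * real n + 1) * ((real n + 2) / 3)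
          + (real n + 1) * ((4 - real n) / 3)"
      unfolding e[symmetric] by (simp only: sum.distrib flip: sum_distrib_left) simp
    have "(\<Sum>i=1..n+1. (\<Sum>j=1..n+1. (\<bar>real i - real j\<bar> + ?e i + ?e j) * ?d j) * ?d i)
        = (\<Sum>i=1..n+1. (5 * A i + (5 * real n + 1) * ?e i + (4 - real n) / 3) * ?d i)"
      using inner by (intro sum.cong) auto
    also have "\<dots> = (25 * real n ^ 3 + 65 * real n ^ 2 + 64 * real n + 8) / 3"
    proof -
      \<comment> \<open>These are the boundary values needed to remove the outer degree weight in
        the same way as the inner one.\<close>
      have "A 1 = real n * (real n + 1) / 2" "A (n + 1) = real n * (real n + 1) / 2"
        using A[of 1] A[of "n + 1"] by (simp_all add: field_simps)
      then show ?thesis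
        unfolding sum_column_degree outer ends
        by (simp add: field_simps power2_eq_square power3_eq_cube)
    qed
    finally show ?thesis .
  qed
  finally show ?thesis by simp
qed

end
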